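(* Let $0<\alpha<1$ and let $b>0$ be real. Let $L:[0,b]\times\mathbb{R}\times\mathbb{R}\to\mathbb{R}$, and assume that the functional $J:C^2[0,b]\to\mathbb{R}$ of the form $$J(f)=\int_0^b L\big(t,f(t),({}^{ABC}{}_{0}D^\alpha f)(t)\big)\,dt$$ has a local extremum in $S=\{y\in C^2[0,b]: y(0)=A,\ y(b)=C\}$ (where $A,C\in\mathbb{R}$ are given) at some $f\in S$. Then $$L_1(s)+({}^{ABR}D_b^\alpha L_2)(s)=0\qquad\text{for all } s\in[0,b],$$ where $L_1(s)$ and $L_2(s)$ denote the partial derivatives of $L$ with respect to its second and third arguments, respectively, evaluated at $\big(s,f(s),({}^{ABC}{}_{0}D^\alpha f)(s)\big)$.
   Context: $B(\alpha)>0$ is a normalization constant depending on $\alpha$, and $E_\alpha(z)=\sum_{k\ge0}\frac{z^k}{\Gamma(\alpha k+1)}$ is the Mittag-Leffler function. The left Caputo-type and right Riemann-Liouville-type fractional derivatives with Mittag-Leffler kernel are $$({}^{ABC}{}_{0}D^\alpha f)(t)=\frac{B(\alpha)}{1-\alpha}\int_0^t f'(x)\,E_\alpha\!\left[-\alpha\frac{(t-x)^\alpha}{1-\alpha}\right]dx,$$ $$({}^{ABR}D_b^\alpha f)(t)=-\frac{B(\alpha)}{1-\alpha}\frac{d}{dt}\int_t^b f(x)\,E_\alpha\!\left[-\alpha\frac{(x-t)^\alpha}{1-\alpha}\right]dx,$$ with one-sided derivatives at the endpoints. $J$ has a local maximum in $S$ at $f$ if there is $\epsilon>0$ such that $J(\widehat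 f)\le J(f)$ for all $\widehat f\in S$ with $\|\widehat f-f\|=\sup_{t\in[0,b]}|\widehat f(t)-f(t)|<\epsilon$; a local minimum is defined with the reverse inequality, and a local extremum is a local maximum or minimum. The partial derivatives of $L$ with respect to its second and third arguments are understood to exist.
   Formalization: The partial derivatives of L in its second and third arguments are assumed to exist and be jointly continuous on [0,b]×ℝ×ℝ; with mere existence the claim fails (L=0 for t≠t₀, L(t₀,y,z)=y). *)

theory Defs
  imports "HOL-Analysis.Analysis"
begin

text \<open>
  A function on the interval from 0 to b is a total function on the reals of which only the values
  on \<^term>\<open>{0..b}\<close> are used.  Derivatives are taken within \<^term>\<open>{0..b}\<close>: they are two-sided in
  the interior and one-sided at the two endpoints.
\<close>

definition mittag_leffler :: "real \<Rightarrow> real \<Rightarrow> real" where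
  "mittag_leffler \<alpha> z = (\<Sum>k. z ^ k / Gamma (\<alpha> * real k + 1))"

text \<open>\<open>ml_kernel \<alpha> u\<close> is the kernel at the (nonnegative) lag \<open>u\<close>; at \<open>u = 0\<close> the convention
  \<^prop>\<open>(0::real) powr \<alpha> = 0\<close> gives the intended value \<open>0\<close> of the power, as \<open>\<alpha> > 0\<close>.\<close>

definition ml_kernel :: "real \<Rightarrow> real \<Rightarrow> real" where
  "ml_kernel \<alpha> u = mittag_leffler \<alpha> (- \<alpha> * (u powr \<alpha> / (1 - \<alpha>)))"

definition abc_left ::
    "(real \<Rightarrow> real) \<Rightarrow> real \<Rightarrow> real \<Rightarrow> (real \<Rightarrow> real) \<Rightarrow> real \<Rightarrow> real" where
  "abc_left B \<alpha> b f t = B \<alpha> / (1 - \<alpha>) *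
     integral {0..t} (\<lambda>x. vector_derivative f (at x within {0..b}) * ml_kernel \<alpha> (t - x))"

text \<open>The integral under \<open>d/dt\<close> in the right derivative is named separately, because
  \<^const>\<open>vector_derivative\<close> is total and existence of the derivative has to be stated explicitly.\<close>

definition abr_right_integral :: "real \<Rightarrow> real \<Rightarrow> (real \<Rightarrow> real) \<Rightarrow> real \<Rightarrow> real" where
  "abr_right_integral \<alpha> b g t = integral {t..b} (\<lambda>x. g x * ml_kernel \<alpha> (x - t))"

definition abr_right_exists_at :: "real \<Rightarrow> real \<Rightarrow> (real \<Rightarrow> real) \<Rightarrow> real \<Rightarrow> bool" where
  "abr_right_exists_at \<alpha> b g t \<longleftrightarrow>
     abr_right_integral \<alpha> b g differentiable (at t within {0..b})"

definition abr_right ::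
    "(real \<Rightarrow> real) \<Rightarrow> real \<Rightarrow> real \<Rightarrow> (real \<Rightarrow> real) \<Rightarrow> real \<Rightarrow> real" where
  "abr_right B \<alpha> b g t = - (B \<alpha> / (1 - \<alpha>)) *
     vector_derivative (abr_right_integral \<alpha> b g) (at t within {0..b})"

definition C2 :: "real \<Rightarrow> (real \<Rightarrow> real) set" where
  "C2 b = {f. \<exists>f' f''.
     (\<forall>t\<in>{0..b}. (f has_real_derivative f' t) (at t within {0..b})) \<and>
     (\<forall>t\<in>{0..b}. (f' has_real_derivative f'' t) (at t within {0..b})) \<and>
     continuous_on {0..b} f''}"

definition admissible :: "real \<Rightarrow> real \<Rightarrow> real \<Rightarrow> (real \<Rightarrow> real) set" where
  "admissible b A C = {y \<in> C2 b. y 0 = A \<and> y b = C}"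

definition sup_norm :: "real \<Rightarrow> (real \<Rightarrow> real) \<Rightarrow> real" where
  "sup_norm b h = (SUP t\<in>{0..b}. \<bar>h t\<bar>)"

definition local_max ::
    "real \<Rightarrow> (real \<Rightarrow> real) set \<Rightarrow> ((real \<Rightarrow> real) \<Rightarrow> real) \<Rightarrow> (real \<Rightarrow> real) \<Rightarrow> bool" where
  "local_max b S J f \<longleftrightarrow> f \<in> S \<and>
     (\<exists>\<epsilon>>0. \<forall>g\<in>S. sup_norm b (\<lambda>t. g t - f t) < \<epsilon> \<longrightarrow> J g \<le> J f)"

definition local_min ::
    "real \<Rightarrow> (real \<Rightarrow> real) set \<Rightarrow> ((real \<Rightarrow> real) \<Rightarrow> real) \<Rightarrow> (real \<Rightarrow> real) \<Rightarrow> bool" where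
  "local_min b S J f \<longleftrightarrow> f \<in> S \<and>
     (\<exists>\<epsilon>>0. \<forall>g\<in>S. sup_norm b (\<lambda>t. g t - f t) < \<epsilon> \<longrightarrow> J f \<le> J g)"

definition local_extremum ::
    "real \<Rightarrow> (real \<Rightarrow> real) set \<Rightarrow> ((real \<Rightarrow> real) \<Rightarrow> real) \<Rightarrow> (real \<Rightarrow> real) \<Rightarrow> bool" where
  "local_extremum b S J f \<longleftrightarrow> local_max b S J f \<or> local_min b S J f"

definition lagrangian_along ::
    "(real \<Rightarrow> real) \<Rightarrow> real \<Rightarrow> real \<Rightarrow> (real \<Rightarrow> real \<Rightarrow> real \<Rightarrow> real) \<Rightarrow>
      (real \<Rightarrow> real) \<Rightarrow> real \<Rightarrow> real" where
  "lagrangian_along B \<alpha> b L f t = L t (f t) (abc_left B \<alpha> b f t)"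

definition action ::
    "(real \<Rightarrow> real) \<Rightarrow> real \<Rightarrow> real \<Rightarrow> (real \<Rightarrow> real \<Rightarrow> real \<Rightarrow> real) \<Rightarrow>
      (real \<Rightarrow> real) \<Rightarrow> real" where
  "action B \<alpha> b L f = integral {0..b} (lagrangian_along B \<alpha> b L f)"

definition partial2 :: "(real \<Rightarrow> real \<Rightarrow> real \<Rightarrow> real) \<Rightarrow> real \<Rightarrow> real \<Rightarrow> real \<Rightarrow> real" where
  "partial2 L t y z = deriv (\<lambda>u. L t u z) y"

definition partial3 :: "(real \<Rightarrow> real \<Rightarrow> real \<Rightarrow> real) \<Rightarrow> real \<Rightarrow> real \<Rightarrow> real \<Rightarrow> real" where
  "partial3 L t y z = deriv (\<lambda>u. L t y u) z"

text \<open>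
  The partial derivatives exist everywhere and are jointly continuous on \<open>[0,b] \<times> \<real> \<times> \<real>\<close>.
  Existence alone is not enough for a pointwise Euler-Lagrange equation: changing \<open>L\<close> on a single
  slice \<open>t = t\<^sub>0\<close> changes the equation at \<open>t\<^sub>0\<close> but not the functional.
  No continuity of \<open>L\<close> in its first argument is required.
\<close>

definition continuous_partials :: "real \<Rightarrow> (real \<Rightarrow> real \<Rightarrow> real \<Rightarrow> real) \<Rightarrow> bool" where
  "continuous_partials b L \<longleftrightarrow>
     (\<forall>t\<in>{0..b}. \<forall>y z. (\<lambda>u. L t u z) differentiable (at y) \<and> (\<lambda>u. L t y u) differentiable (at z)) \<and>
     continuous_on ({0..b} \<times> UNIV \<times> UNIV) (\<lambda>(t, y, z). partial2 L t y z) \<and>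
     continuous_on ({0..b} \<times> UNIV \<times> UNIV) (\<lambda>(t, y, z). partial3 L t y z)"

end

theory Submission
  imports Defs
begin

text \<open>
  At an extremal \<open>f\<close> the first variation along every \<open>C\<^sup>2\<close> function \<open>\<eta>\<close> vanishing at the endpoints
  is zero.  With \<open>k = B \<alpha> / (1 - \<alpha>)\<close> and \<open>G s\<close> the integral of \<open>L\<^sub>2\<close> against the kernel over
  \<open>[s, b]\<close>, exchanging the order of integration over the triangle \<open>x \<le> t\<close> and integrating
  \<open>L\<^sub>1 \<eta>\<close> by parts turns this into \<open>\<integral> \<eta>' (k G - \<integral>\<^sub>0 L\<^sub>1) = 0\<close>.  Hence \<open>k G - \<integral>\<^sub>0 L\<^sub>1\<close> is constant
  (du Bois-Reymond), so \<open>G\<close> is differentiable up to the endpoints with \<open>k G' = L\<^sub>1\<close>.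
\<close>

section \<open>The Mittag-Leffler kernel: convergence and continuity\<close>

text \<open>Keep only the part of the Gamma integral over t \<ge> M: there
  \<open>t powr (x - 1)\<close> is at least \<open>M powr (x - 1)\<close> because x \<ge> 1, and the
  remaining exponential integrates to \<open>exp (- M)\<close>. As M is free,
  \<open>Gamma (\<alpha> * real k + 1)\<close> outgrows every geometric sequence in k.\<close>

lemma Gamma_real_ge:
  assumes "x \<ge> 1" and "M > 0"
  shows "M powr (x - 1) * exp (- M) \<le> Gamma (x :: real)"
proof (rule has_integral_le)
  show "((\<lambda>t. if t \<in> {M..} then M powr (x - 1) * exp (-1 * t) else 0) has_integral
      M powr (x - 1) * exp (- M)) {0..}"
    using has_integral_mult_right[OF has_integral_exp_minus_to_infinity[of 1 M],
        of "M powr (x - 1)"] \<open>M > 0\<close>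
    by (subst has_integral_restrict) auto
  show "((\<lambda>t. t powr (x - 1) / exp t) has_integral Gamma x) {0..}"
    using assms by (intro Gamma_integral_real) auto
  show "(if t \<in> {M..} then M powr (x - 1) * exp (-1 * t) else 0) \<le> t powr (x - 1) / exp t"
    if "t \<in> {0..}" for t
    using assms by (auto simp: exp_minus field_simps intro!: powr_mono2)
qed

lemma summable_mittag_leffler:
  fixes \<alpha> z :: real
  assumes "\<alpha> > 0"
  shows "summable (\<lambda>k. z ^ k / Gamma (\<alpha> * real k + 1))"
proof -
  \<comment> \<open>With this choice \<open>M powr (\<alpha> * real k)\<close> is the k-th power of
    \<open>2 * \<bar>z\<bar> + 1\<close>, so the terms of the series are dominated by
    \<open>exp M\<close> times powers of a ratio at most 1/2. The summand 1 keeps M positive when z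
    = 0.\<close>
  define M where "M = (2 * \<bar>z\<bar> + 1) powr (1 / \<alpha>)"
  have M: "M > 0" by (simp add: M_def)
  have M\<alpha>: "M powr \<alpha> = 2 * \<bar>z\<bar> + 1"
    using assms by (simp add: M_def powr_powr)
  have bound: "norm (z ^ k / Gamma (\<alpha> * real k + 1)) \<le> exp M * (1 / 2) ^ k" for k
  proof -
    have "(2 * \<bar>z\<bar> + 1) ^ k * exp (- M) = M powr (\<alpha> * real k) * exp (- M)"
      using M by (simp flip: M\<alpha> add: powr_powr powr_realpow[symmetric])
    also have "\<dots> \<le> Gamma (\<alpha> * real k + 1)"
      using Gamma_real_ge[of "\<alpha> * real k + 1" M] assms M by simp
    finally have le: "(2 * \<bar>z\<bar> + 1) ^ k * exp (- M) \<le> Gamma (\<alpha> * real k + 1)" .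
    have pos: "0 < (2 * \<bar>z\<bar> + 1) ^ k * exp (- M)" by (intro mult_pos_pos zero_less_power) auto
    have Gamma_pos: "0 < Gamma (\<alpha> * real k + 1)" using pos le by (rule less_le_trans)
    have "norm (z ^ k / Gamma (\<alpha> * real k + 1)) = \<bar>z\<bar> ^ k / Gamma (\<alpha> * real k + 1)"
      using Gamma_pos by (simp add: power_abs)
    also have "\<dots> \<le> \<bar>z\<bar> ^ k / ((2 * \<bar>z\<bar> + 1) ^ k * exp (- M))"
      using le pos Gamma_pos by (intro divide_left_mono mult_pos_pos) auto
    also have "\<dots> = exp M * (\<bar>z\<bar> / (2 * \<bar>z\<bar> + 1)) ^ k"
      by (simp add: exp_minus power_divide field_simps)
    also have "\<dots> \<le> exp M * (1 / 2) ^ k"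
      by (intro mult_left_mono power_mono) (auto simp: field_simps)
    finally show ?thesis .
  qed
  show ?thesis
    by (rule summable_comparison_test'[OF _ bound]) (intro summable_mult summable_geometric, simp)
qed

lemma isCont_mittag_leffler:
  assumes "\<alpha> > 0"
  shows "isCont (mittag_leffler \<alpha>) z"
  using isCont_powser_converges_everywhere[of "\<lambda>k. 1 / Gamma (\<alpha> * real k + 1)" z]
    summable_mittag_leffler[OF assms]
  by (simp add: mittag_leffler_def[abs_def])

text \<open>The rest of the proof uses only this continuity of the kernel, lag 0 included. For
  \<alpha> < 1 the kernel has infinite slope at lag 0, so it is never differentiated.\<close>

lemma continuous_on_ml_kernel:
  assumes "\<alpha> > 0"
  shows "continuous_on {0..} (ml_kernel \<alpha>)"
proof -
  have "continuous_on UNIV (mittag_leffler \<alpha>)"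
    using isCont_mittag_leffler[OF assms] by (simp add: continuous_at_imp_continuous_on)
  moreover have "continuous_on {0..} (\<lambda>u::real. - \<alpha> * (u powr \<alpha> / (1 - \<alpha>)))"
    unfolding divide_inverse using assms by (intro continuous_intros continuous_on_powr') auto
  ultimately show ?thesis
    unfolding ml_kernel_def[abs_def] by (rule continuous_on_compose2) auto
qed

section \<open>Convolutions with a continuous kernel\<close>

lemma continuous_on_lag:
  fixes K g :: "_ \<Rightarrow> real"
  assumes "continuous_on {0..} K" and "continuous_on S g"
  shows "continuous_on S (\<lambda>x. K (max 0 (g x)))"
  by (rule continuous_on_compose2[OF assms(1)]) (auto intro!: continuous_intros assms(2))

text \<open>Truncating the lag at \<open>0\<close> makes the integrand continuous on the whole square, so that
  parameter integrals and Fubini on rectangles apply; the excess over the triangle involves only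
  the constant \<open>K 0\<close>.\<close>

context
  fixes K h :: "real \<Rightarrow> real" and b :: real
  assumes K: "continuous_on {0..} K" and h: "continuous_on {0..b} h"
begin

lemma left_convolution_eq:
  assumes "t \<in> {0..b}"
  shows "integral {0..t} (\<lambda>x. h x * K (t - x)) =
    integral {0..b} (\<lambda>x. h x * K (max 0 (t - x))) - K 0 * (integral {0..b} h - integral {0..t} h)"
proof -
  have "integral {0..t} (\<lambda>x. h x * K (max 0 (t - x))) +
      integral {t..b} (\<lambda>x. h x * K (max 0 (t - x))) =
      integral {0..b} (\<lambda>x. h x * K (max 0 (t - x)))"
    using assms by (intro Henstock_Kurzweil_Integration.integral_combine
      integrable_continuous_interval continuous_intros continuous_on_lag[OF K]
      continuous_on_subset[OF h]) auto
  moreover have "integral {0..t} (\<lambda>x. h x * K (max 0 (t - x))) =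
      integral {0..t} (\<lambda>x. h x * K (t - x))"
    by (rule integral_cong) auto
  moreover have "integral {t..b} (\<lambda>x. h x * K (max 0 (t - x))) = integral {t..b} (\<lambda>x. h x * K 0)"
    by (rule integral_cong) auto
  \<comment> \<open>The tail is expressed through integrals starting at 0, whose dependence on t is
    that of an indefinite integral.\<close>
  moreover have tail: "integral {0..b} h - integral {0..t} h = integral {t..b} h"
    using assms Henstock_Kurzweil_Integration.integral_combine[of 0 t b h]
      integrable_continuous_interval[OF h] by simp
  ultimately show ?thesis unfolding tail by (simp add: algebra_simps)
qed

lemma right_convolution_eq:
  assumes "t \<in> {0..b}"
  shows "integral {t..b} (\<lambda>x. h x * K (x - t)) =
    integral {0..b} (\<lambda>x. h x * K (max 0 (x - t))) - K 0 * integral {0..t} h"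
proof -
  have "integral {0..t} (\<lambda>x. h x * K (max 0 (x - t))) +
      integral {t..b} (\<lambda>x. h x * K (max 0 (x - t))) =
      integral {0..b} (\<lambda>x. h x * K (max 0 (x - t)))"
    using assms by (intro Henstock_Kurzweil_Integration.integral_combine
      integrable_continuous_interval continuous_intros continuous_on_lag[OF K]
      continuous_on_subset[OF h]) auto
  moreover have "integral {t..b} (\<lambda>x. h x * K (max 0 (x - t))) =
      integral {t..b} (\<lambda>x. h x * K (x - t))"
    by (rule integral_cong) auto
  moreover have "integral {0..t} (\<lambda>x. h x * K (max 0 (x - t))) = integral {0..t} (\<lambda>x. h x * K 0)"
    by (rule integral_cong) auto
  ultimately show ?thesis by (simp add: algebra_simps)
qed

text \<open>The lag is a general jointly continuous \<open>g\<close>, so that both t - x and x - t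
  are covered.\<close>

lemma continuous_on_integral_lag:
  assumes "continuous_on UNIV (\<lambda>(t, x). g t x :: real)"
  shows "continuous_on {0..b} (\<lambda>t. integral {0..b} (\<lambda>x. h x * K (max 0 (g t x))))"
proof -
  have "continuous_on ({0..b} \<times> {0..b}) (\<lambda>p. h (snd p) * K (max 0 (g (fst p) (snd p))))"
    using assms by (intro continuous_intros continuous_on_lag[OF K] continuous_on_compose2[OF h])
      (auto simp: case_prod_unfold intro: continuous_on_subset)
  then show ?thesis
    using integral_continuous_on_param[of "{0..b}" 0 b "\<lambda>t x. h x * K (max 0 (g t x))"]
    by (simp add: case_prod_unfold)
qed

text \<open>\<open>left_convolution_eq\<close> removes t from the limits of the convolution, leaving
  a parameter integral over a fixed interval and an indefinite integral.\<close>

lemma continuous_on_left_convolution: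
  "continuous_on {0..b} (\<lambda>t. integral {0..t} (\<lambda>x. h x * K (t - x)))"
proof -
  have "continuous_on {0..b} (\<lambda>t. integral {0..b} (\<lambda>x. h x * K (max 0 (t - x))) -
      K 0 * (integral {0..b} h - integral {0..t} h))"
    by (intro continuous_intros continuous_on_integral_lag indefinite_integral_continuous_1
        integrable_continuous_interval h) (auto simp: case_prod_unfold intro!: continuous_intros)
  then show ?thesis
    by (rule continuous_on_eq) (simp add: left_convolution_eq)
qed

lemma continuous_on_right_convolution:
  "continuous_on {0..b} (\<lambda>t. integral {t..b} (\<lambda>x. h x * K (x - t)))"
proof -
  have "continuous_on {0..b} (\<lambda>t. integral {0..b} (\<lambda>x. h x * K (max 0 (x - t))) -
      K 0 * integral {0..t} h)"
    by (intro continuous_intros continuous_on_integral_lag indefinite_integral_continuous_1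
        integrable_continuous_interval h) (auto simp: case_prod_unfold intro!: continuous_intros)
  then show ?thesis
    by (rule continuous_on_eq) (simp add: right_convolution_eq)
qed

end

section \<open>Exchanging the order of integration over a triangle\<close>

text \<open>The product of the integral of \<open>g\<close> over [a, t] and that of \<open>h\<close>
  over [t, b] vanishes at both ends, and its derivative is the difference of the two integrands.
  This is Fubini on the triangle for a separable integrand; it serves below both for the constant
  \<open>K 0\<close> and for integrating L1 \<eta> by parts.\<close>

lemma integral_by_parts_indefinite:
  fixes g h :: "real \<Rightarrow> real"
  assumes "a \<le> b" and g: "continuous_on {a..b} g" and h: "continuous_on {a..b} h"
  shows "integral {a..b} (\<lambda>t. g t * (integral {a..b} h - integral {a..t} h)) =
    integral {a..b} (\<lambda>t. h t * integral {a..t} g)"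
proof -
  have "((\<lambda>t. g t * (integral {a..b} h - integral {a..t} h) - h t * integral {a..t} g) has_integral
      integral {a..b} g * (integral {a..b} h - integral {a..b} h) -
      integral {a..a} g * (integral {a..b} h - integral {a..a} h)) {a..b}"
    using \<open>a \<le> b\<close>
    by (intro fundamental_theorem_of_calculus)
      (auto simp flip: has_real_derivative_iff_has_vector_derivative
        intro!: derivative_eq_intros integral_has_real_derivative g h)
  then have "integral {a..b} (\<lambda>t. g t * (integral {a..b} h - integral {a..t} h) -
      h t * integral {a..t} g) = 0"
    by (simp add: integral_unique)
  then show ?thesis
    by (subst (asm) Henstock_Kurzweil_Integration.integral_diff)
      (auto intro!: integrable_continuous_interval continuous_intros g h
        indefinite_integral_continuous_1)
qed

text \<open>Cut off to the triangle, the integrand may jump across the diagonal. Fubini is therefore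
  applied to the truncated lag on the square, and the two excess terms, both multiples of
  \<open>K 0\<close>, agree by \<open>integral_by_parts_indefinite\<close>.\<close>

lemma integral_swap_convolution:
  fixes K g h :: "real \<Rightarrow> real"
  assumes "0 \<le> b" and K: "continuous_on {0..} K"
    and g: "continuous_on {0..b} g" and h: "continuous_on {0..b} h"
  shows "integral {0..b} (\<lambda>t. g t * integral {0..t} (\<lambda>x. h x * K (t - x))) =
    integral {0..b} (\<lambda>x. h x * integral {x..b} (\<lambda>t. g t * K (t - x)))"
proof -
  note lag = continuous_on_lag[OF K]
  have contl: "continuous_on {0..b} (\<lambda>t. integral {0..b} (\<lambda>x. h x * K (max 0 (t - x))))"
    by (intro continuous_on_integral_lag K h) (auto simp: case_prod_unfold intro!: continuous_intros)
  have contr: "continuous_on {0..b} (\<lambda>x. integral {0..b} (\<lambda>t. g t * K (max 0 (t - x))))"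
    by (intro continuous_on_integral_lag K g) (auto simp: case_prod_unfold intro!: continuous_intros)
  have "continuous_on (cbox (0, 0) (b, b)) (\<lambda>(t, x). g t * (h x * K (max 0 (t - x))))"
    unfolding case_prod_unfold
    by (intro continuous_intros lag continuous_on_compose2[OF g] continuous_on_compose2[OF h])
      (auto simp: mem_Times_iff)
  from integral_swap_continuous[OF this]
  have swap: "integral {0..b} (\<lambda>t. g t * integral {0..b} (\<lambda>x. h x * K (max 0 (t - x)))) =
      integral {0..b} (\<lambda>x. h x * integral {0..b} (\<lambda>t. g t * K (max 0 (t - x))))"
    by (simp add: algebra_simps flip: integral_mult_right)
  have "integral {0..b} (\<lambda>t. g t * integral {0..t} (\<lambda>x. h x * K (t - x))) =
      integral {0..b} (\<lambda>t. g t * integral {0..b} (\<lambda>x. h x * K (max 0 (t - x))) -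
        K 0 * (g t * (integral {0..b} h - integral {0..t} h)))"
    by (rule integral_cong) (simp add: left_convolution_eq[OF K h] algebra_simps)
  also have "\<dots> = integral {0..b} (\<lambda>t. g t * integral {0..b} (\<lambda>x. h x * K (max 0 (t - x)))) -
      K 0 * integral {0..b} (\<lambda>t. g t * (integral {0..b} h - integral {0..t} h))"
    by (subst Henstock_Kurzweil_Integration.integral_diff)
      (auto intro!: integrable_continuous_interval continuous_intros g h contl
        indefinite_integral_continuous_1)
  also have "\<dots> = integral {0..b} (\<lambda>x. h x * integral {0..b} (\<lambda>t. g t * K (max 0 (t - x)))) -
      K 0 * integral {0..b} (\<lambda>x. h x * integral {0..x} g)"
    by (simp only: swap integral_by_parts_indefinite[OF \<open>0 \<le> b\<close> g h])
  also have "\<dots> = integral {0..b} (\<lambda>x. h x * integral {0..b} (\<lambda>t. g t * K (max 0 (t - x))) -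
      K 0 * (h x * integral {0..x} g))"
    by (subst Henstock_Kurzweil_Integration.integral_diff)
      (auto intro!: integrable_continuous_interval continuous_intros g h contr
        indefinite_integral_continuous_1)
  also have "\<dots> = integral {0..b} (\<lambda>x. h x * integral {x..b} (\<lambda>t. g t * K (t - x)))"
    by (rule integral_cong) (simp add: right_convolution_eq[OF K g] algebra_simps)
  finally show ?thesis .
qed

section \<open>Twice differentiable functions and the left fractional derivative\<close>

lemma C2_imp_C1:
  assumes "y \<in> C2 b"
  obtains y' where "\<And>t. t \<in> {0..b} \<Longrightarrow> (y has_real_derivative y' t) (at t within {0..b})"
    and "continuous_on {0..b} y'"
  using assms unfolding C2_def by (blast intro: DERIV_continuous_on)

lemma C2_add_scaled:
  assumes "y \<in> C2 b" and "\<eta> \<in> C2 b"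
  shows "(\<lambda>t. y t + \<epsilon> * \<eta> t) \<in> C2 b"
proof -
  obtain y' y'' where y: "\<And>t. t \<in> {0..b} \<Longrightarrow> (y has_real_derivative y' t) (at t within {0..b})"
    "\<And>t. t \<in> {0..b} \<Longrightarrow> (y' has_real_derivative y'' t) (at t within {0..b})"
    "continuous_on {0..b} y''"
    using assms(1) unfolding C2_def by blast
  obtain \<eta>' \<eta>'' where \<eta>: "\<And>t. t \<in> {0..b} \<Longrightarrow> (\<eta> has_real_derivative \<eta>' t) (at t within {0..b})"
    "\<And>t. t \<in> {0..b} \<Longrightarrow> (\<eta>' has_real_derivative \<eta>'' t) (at t within {0..b})"
    "continuous_on {0..b} \<eta>''"
    using assms(2) unfolding C2_def by blast
  have "((\<lambda>t. y t + \<epsilon> * \<eta> t) has_real_derivative y' t + \<epsilon> * \<eta>' t) (at t within {0..b})"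
    "((\<lambda>t. y' t + \<epsilon> * \<eta>' t) has_real_derivative y'' t + \<epsilon> * \<eta>'' t) (at t within {0..b})"
    if "t \<in> {0..b}" for t
    using y(1,2)[OF that] \<eta>(1,2)[OF that] by (auto intro!: derivative_eq_intros)
  moreover have "continuous_on {0..b} (\<lambda>t. y'' t + \<epsilon> * \<eta>'' t)"
    by (intro continuous_intros y \<eta>)
  ultimately show ?thesis
    unfolding C2_def mem_Collect_eq
    by (intro exI[of _ "\<lambda>t. y' t + \<epsilon> * \<eta>' t"] exI[of _ "\<lambda>t. y'' t + \<epsilon> * \<eta>'' t"]) auto
qed

text \<open>On an interval of positive length derivatives are unique, endpoints included, so the
  total operator \<open>vector_derivative\<close> can be traded for any known derivative
  \<open>y'\<close>.\<close>

lemma abc_left_eq: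
  assumes "\<And>x. x \<in> {0..b} \<Longrightarrow> (y has_real_derivative y' x) (at x within {0..b})"
    and "0 < b" and "t \<in> {0..b}"
  shows "abc_left B \<alpha> b y t =
    B \<alpha> / (1 - \<alpha>) * integral {0..t} (\<lambda>x. y' x * ml_kernel \<alpha> (t - x))"
proof -
  have "vector_derivative y (at x within {0..b}) = y' x" if "x \<in> {0..t}" for x
    using assms that
    by (intro vector_derivative_within_closed_interval)
      (auto simp flip: has_real_derivative_iff_has_vector_derivative)
  then have "integral {0..t} (\<lambda>x. vector_derivative y (at x within {0..b}) * ml_kernel \<alpha> (t - x)) =
      integral {0..t} (\<lambda>x. y' x * ml_kernel \<alpha> (t - x))"
    by (intro integral_cong) simp
  then show ?thesis by (simp add: abc_left_def)
qed

lemma continuous_on_abc_left: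
  assumes "0 < \<alpha>" and "0 < b" and "y \<in> C2 b"
  shows "continuous_on {0..b} (abc_left B \<alpha> b y)"
proof -
  obtain y' where y': "\<And>t. t \<in> {0..b} \<Longrightarrow> (y has_real_derivative y' t) (at t within {0..b})"
    "continuous_on {0..b} y'"
    using C2_imp_C1[OF assms(3)] by blast
  have "continuous_on {0..b}
      (\<lambda>t. B \<alpha> / (1 - \<alpha>) * integral {0..t} (\<lambda>x. y' x * ml_kernel \<alpha> (t - x)))"
    by (intro continuous_intros continuous_on_left_convolution continuous_on_ml_kernel assms y')
  then show ?thesis
    by (rule continuous_on_eq) (rule abc_left_eq[symmetric, OF y'(1) \<open>0 < b\<close>])
qed

text \<open>Makes both function arguments of L affine in \<epsilon> along a variation, the form
  required by \<open>first_variation\<close>.\<close>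

lemma abc_left_add_scaled:
  assumes "0 < \<alpha>" and "0 < b" and "y \<in> C2 b" and "\<eta> \<in> C2 b" and t: "t \<in> {0..b}"
  shows "abc_left B \<alpha> b (\<lambda>x. y x + \<epsilon> * \<eta> x) t =
    abc_left B \<alpha> b y t + \<epsilon> * abc_left B \<alpha> b \<eta> t"
proof -
  obtain y' where y': "\<And>t. t \<in> {0..b} \<Longrightarrow> (y has_real_derivative y' t) (at t within {0..b})"
    "continuous_on {0..b} y'"
    using C2_imp_C1[OF assms(3)] by blast
  obtain \<eta>' where \<eta>': "\<And>t. t \<in> {0..b} \<Longrightarrow> (\<eta> has_real_derivative \<eta>' t) (at t within {0..b})"
    "continuous_on {0..b} \<eta>'"
    using C2_imp_C1[OF assms(4)] by blast
  have D: "((\<lambda>x. y x + \<epsilon> * \<eta> x) has_real_derivative y' x + \<epsilon> * \<eta>' x) (at x within {0..b})"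
    if "x \<in> {0..b}" for x
    using y'(1)[OF that] \<eta>'(1)[OF that] by (auto intro!: derivative_eq_intros)
  have int: "(\<lambda>x. h x * ml_kernel \<alpha> (t - x)) integrable_on {0..t}"
    if "continuous_on {0..b} h" for h
    using t by (intro integrable_continuous_interval continuous_intros continuous_on_subset[OF that]
      continuous_on_compose2[OF continuous_on_ml_kernel[OF \<open>0 < \<alpha>\<close>]]) auto
  have "integral {0..t} (\<lambda>x. (y' x + \<epsilon> * \<eta>' x) * ml_kernel \<alpha> (t - x)) =
      integral {0..t} (\<lambda>x. y' x * ml_kernel \<alpha> (t - x)) +
      \<epsilon> * integral {0..t} (\<lambda>x. \<eta>' x * ml_kernel \<alpha> (t - x))"
    using integral_add[OF int[OF y'(2)] integrable_on_cmult_left[OF int[OF \<eta>'(2)], of \<epsilon>]]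
    by (simp add: algebra_simps)
  moreover have "abc_left B \<alpha> b (\<lambda>x. y x + \<epsilon> * \<eta> x) t =
      B \<alpha> / (1 - \<alpha>) * integral {0..t} (\<lambda>x. (y' x + \<epsilon> * \<eta>' x) * ml_kernel \<alpha> (t - x))"
    by (rule abc_left_eq[OF D \<open>0 < b\<close> t])
  moreover have "abc_left B \<alpha> b y t =
      B \<alpha> / (1 - \<alpha>) * integral {0..t} (\<lambda>x. y' x * ml_kernel \<alpha> (t - x))"
    by (rule abc_left_eq[OF y'(1) \<open>0 < b\<close> t])
  moreover have "abc_left B \<alpha> b \<eta> t =
      B \<alpha> / (1 - \<alpha>) * integral {0..t} (\<lambda>x. \<eta>' x * ml_kernel \<alpha> (t - x))"
    by (rule abc_left_eq[OF \<eta>'(1) \<open>0 < b\<close> t])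
  ultimately show ?thesis by (simp only: distrib_left mult.left_commute)
qed

section \<open>Differentiating the functional along a variation\<close>

text \<open>\<open>S\<close> may lie in any space: it will be [0, b], the plane of all (y, z) at a
  fixed t, and the strip of all (\<epsilon>, t).\<close>

lemma continuous_on_partials_along:
  assumes "continuous_partials b L"
    and "continuous_on S t" "t ` S \<subseteq> {0..b}" "continuous_on S y" "continuous_on S z"
  shows "continuous_on S (\<lambda>x. partial2 L (t x) (y x) (z x))"
    and "continuous_on S (\<lambda>x. partial3 L (t x) (y x) (z x))"
proof -
  have "continuous_on S (\<lambda>x. g (t x) (y x) (z x))"
    if "continuous_on ({0..b} \<times> UNIV \<times> UNIV) (\<lambda>(t, y, z). g t y z)"
    for g :: "real \<Rightarrow> real \<Rightarrow> real \<Rightarrow> real"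
  proof -
    have "continuous_on S (\<lambda>x. (t x, y x, z x))"
      by (intro continuous_on_Pair assms)
    moreover have "(\<lambda>x. (t x, y x, z x)) ` S \<subseteq> {0..b} \<times> UNIV \<times> UNIV"
      using assms(3) by auto
    ultimately show ?thesis
      using continuous_on_compose2[OF that] by fastforce
  qed
  then show "continuous_on S (\<lambda>x. partial2 L (t x) (y x) (z x))"
    and "continuous_on S (\<lambda>x. partial3 L (t x) (y x) (z x))"
    using assms(1) by (simp_all add: continuous_partials_def)
qed

text \<open>Both partial derivatives exist and the one in z is continuous, which yields joint
  differentiability; the chain rule for a simultaneous change of y and z rests on this.\<close>

lemma has_derivative_lagrangian:
  assumes L: "continuous_partials b L" and t: "t \<in> {0..b}"
  shows "((\<lambda>(y, z). L t y z) has_derivative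
    (\<lambda>(dy, dz). partial2 L t y z * dy + partial3 L t y z * dz)) (at (y, z))"
proof -
  have d: "((\<lambda>u. L t u z) has_real_derivative partial2 L t y z) (at y)"
    "((\<lambda>u. L t y u) has_real_derivative partial3 L t y z) (at z)" for y z
    using L t unfolding continuous_partials_def partial2_def partial3_def
    by (auto simp: DERIV_deriv_iff_real_differentiable)
  \<comment> \<open>\<open>has_derivative_partialsI\<close> asks for continuity of the last partial
    derivative as a map into bounded linear maps, here multiplication by
    \<open>partial3\<close>.\<close>
  have "continuous_on UNIV (\<lambda>p. blinfun_mult_right (partial3 L t (fst p) (snd p)))"
    by (intro bounded_linear.continuous_on[OF bounded_linear_blinfun_mult_right]
        continuous_on_partials_along[OF L] continuous_intros) (use t in auto)
  then have "continuous (at (y, z) within UNIV \<times> UNIV)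
      (\<lambda>(y, z). blinfun_mult_right (partial3 L t y z))"
    by (simp add: continuous_on_eq_continuous_at case_prod_unfold)
  then have "((\<lambda>(y, z). L t y z) has_derivative
    (\<lambda>(dy, dz). partial2 L t y z * dy + blinfun_mult_right (partial3 L t y z) dz))
    (at (y, z) within UNIV \<times> UNIV)"
    using d by (intro has_derivative_partialsI) (auto simp: has_field_derivative_def)
  then show ?thesis by simp
qed

text \<open>Differentiation under the integral sign, where only the \<epsilon>-derivative
  \<open>D\<close> has to be jointly continuous. L itself may be discontinuous in t, so
  integrability is assumed for each \<epsilon>.\<close>

lemma first_variation:
  assumes L: "continuous_partials b L"
    and cont: "continuous_on {0..b} u" "continuous_on {0..b} v"
      "continuous_on {0..b} p" "continuous_on {0..b} q"
    and int: "\<And>\<epsilon>. (\<lambda>t. L t (u t + \<epsilon> * p t) (v t + \<epsilon> * q t)) integrable_on {0..b}"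
  shows "((\<lambda>\<epsilon>. integral {0..b} (\<lambda>t. L t (u t + \<epsilon> * p t) (v t + \<epsilon> * q t)))
    has_real_derivative
      integral {0..b} (\<lambda>t. partial2 L t (u t) (v t) * p t + partial3 L t (u t) (v t) * q t)) (at 0)"
proof -
  define D where "D \<epsilon> t = partial2 L t (u t + \<epsilon> * p t) (v t + \<epsilon> * q t) * p t +
    partial3 L t (u t + \<epsilon> * p t) (v t + \<epsilon> * q t) * q t" for \<epsilon> t
  have "((\<lambda>\<epsilon>. L t (u t + \<epsilon> * p t) (v t + \<epsilon> * q t)) has_real_derivative D \<epsilon> t) (at \<epsilon>)"
    if "t \<in> {0..b}" for \<epsilon> t
  proof -
    have "((\<lambda>\<epsilon>. (u t + \<epsilon> * p t, v t + \<epsilon> * q t)) has_derivative (\<lambda>e. (e * p t, e * q t))) (at \<epsilon>)"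
      by (auto intro!: derivative_eq_intros)
    from has_derivative_compose[OF this has_derivative_lagrangian[OF L that]]
    show ?thesis
      unfolding case_prod_conv
      by (rule has_derivative_imp_has_field_derivative) (simp add: D_def algebra_simps)
  qed
  moreover have "continuous_on (UNIV \<times> {0..b}) (\<lambda>(\<epsilon>, t). D \<epsilon> t)"
    unfolding D_def case_prod_unfold
    by (intro continuous_intros continuous_on_partials_along[OF L]
        cont[THEN continuous_on_compose2]) auto
  ultimately have "((\<lambda>\<epsilon>. integral (cbox 0 b) (\<lambda>t. L t (u t + \<epsilon> * p t) (v t + \<epsilon> * q t)))
      has_real_derivative integral (cbox 0 b) (D 0)) (at 0 within UNIV)"
    using int by (intro leibniz_rule_field_derivative) auto
  then show ?thesis by (simp add: D_def[abs_def])
qed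

text \<open>Small multiples of \<eta> stay inside the neighbourhood on which the extremum is
  tested.\<close>

lemma sup_norm_scaled_less:
  assumes "continuous_on {0..b} \<eta>" and "0 \<le> b" and "\<delta> > 0"
  obtains d where "d > 0" and "\<And>\<epsilon>. \<bar>\<epsilon>\<bar> < d \<Longrightarrow> sup_norm b (\<lambda>t. \<epsilon> * \<eta> t) < \<delta>"
proof -
  have "bounded (\<eta> ` {0..b})"
    using assms(1) by (intro compact_imp_bounded compact_continuous_image) auto
  then obtain M where M: "M > 0" "\<And>t. t \<in> {0..b} \<Longrightarrow> \<bar>\<eta> t\<bar> \<le> M"
    by (auto simp: bounded_pos)
  show thesis
  proof
    show "\<delta> / M > 0" using M assms by simp
    show "sup_norm b (\<lambda>t. \<epsilon> * \<eta> t) < \<delta>" if "\<bar>\<epsilon>\<bar> < \<delta> / M" for \<epsilon>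
    proof -
      have "sup_norm b (\<lambda>t. \<epsilon> * \<eta> t) \<le> \<bar>\<epsilon>\<bar> * M"
        unfolding sup_norm_def using M assms
        by (intro cSUP_least) (auto simp: abs_mult intro!: mult_left_mono)
      also have "\<dots> < \<delta>" using that M by (simp add: field_simps)
      finally show ?thesis .
    qed
  qed
qed

section \<open>The du Bois-Reymond lemma for twice differentiable test functions\<close>

lemma integral_minus_mean:
  fixes g :: "real \<Rightarrow> real"
  assumes "0 < b" and "continuous_on {0..b} g"
  shows "integral {0..b} (\<lambda>t. g t - integral {0..b} g / b) = 0"
  using assms(1) Henstock_Kurzweil_Integration.integral_diff
    [OF integrable_continuous_interval[OF assms(2)] integrable_const_ivl]
  by simp

text \<open>The usual test function \<open>\<eta>' = Q - c\<close>, with \<open>c\<close> the mean of \<open>Q\<close>, need not have a \<open>C\<^sup>2\<close>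
  antiderivative; it is replaced by uniformly close polynomials of mean \<open>0\<close>.\<close>

lemma du_Bois_Reymond_C2:
  assumes "0 < b" and Q: "continuous_on {0..b} Q"
    and orth: "\<And>\<eta> \<eta>'. \<lbrakk>\<eta> \<in> C2 b; \<eta> 0 = 0; \<eta> b = 0; continuous_on {0..b} \<eta>';
      \<And>t. t \<in> {0..b} \<Longrightarrow> (\<eta> has_real_derivative \<eta>' t) (at t within {0..b})\<rbrakk>
      \<Longrightarrow> integral {0..b} (\<lambda>t. \<eta>' t * Q t) = 0"
  shows "\<exists>c. \<forall>t\<in>{0..b}. Q t = c"
proof -
  define c where "c = integral {0..b} Q / b"
  define R where "R t = Q t - c" for t
  have R: "continuous_on {0..b} R" unfolding R_def by (intro continuous_intros Q)
  have R0: "integral {0..b} R = 0"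
    unfolding R_def c_def by (rule integral_minus_mean[OF \<open>0 < b\<close> Q])
  define N where "N = integral {0..b} (\<lambda>t. \<bar>R t\<bar>)"
  have N: "0 \<le> N"
    unfolding N_def
    by (intro Henstock_Kurzweil_Integration.integral_nonneg integrable_continuous_interval
        continuous_intros R) auto
  \<comment> \<open>Letting e tend to 0 in this bound will force the integral of the square of
    \<open>R\<close> to be 0.\<close>
  have le: "integral {0..b} (\<lambda>t. R t * R t) \<le> 2 * e * N" if "e > 0" for e
  proof -
    obtain p where p: "real_polynomial_function p" "\<And>t. t \<in> {0..b} \<Longrightarrow> \<bar>R t - p t\<bar> < e"
      using Stone_Weierstrass_real_polynomial_function[OF compact_Icc R \<open>e > 0\<close>] by metis
    obtain p' where p': "real_polynomial_function p'" "\<And>x. (p has_real_derivative p' x) (at x)"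
      using has_real_derivative_polynomial_function[OF p(1)] by blast
    have cont_p: "continuous_on {0..b} p" and cont_p': "continuous_on {0..b} p'"
      using p(1) p'(1) by (auto simp: real_polynomial_function_eq intro: continuous_on_polymonial_function)
    define m where "m = integral {0..b} p / b"
    define h where "h t = p t - m" for t
    have h: "continuous_on {0..b} h" unfolding h_def by (intro continuous_intros cont_p)
    \<comment> \<open>\<open>R\<close> has mean 0 and \<open>p\<close> is within e of it, so the
      mean of \<open>p\<close> is at most e in absolute value. Hence \<open>h\<close> is within 2e
      of \<open>R\<close>.\<close>
    have m: "\<bar>m\<bar> \<le> e"
    proof -
      have "integral {0..b} p = integral {0..b} (\<lambda>t. p t - R t)"
        using R0 integrable_continuous_interval[OF R] integrable_continuous_interval[OF cont_p]
        by (simp add: Henstock_Kurzweil_Integration.integral_diff)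
      moreover have "norm (integral {0..b} (\<lambda>t. p t - R t)) \<le> e * (b - 0)"
        using p(2) \<open>0 < b\<close> less_imp_le
        by (intro integral_bound continuous_intros cont_p R) (auto simp: abs_minus_commute less_imp_le)
      ultimately show ?thesis using \<open>0 < b\<close> by (simp add: m_def field_simps)
    qed
    have h0: "integral {0..b} h = 0"
      unfolding h_def m_def by (rule integral_minus_mean[OF \<open>0 < b\<close> cont_p])
    have "integral {0..b} (\<lambda>t. h t * Q t) = 0"
    \<comment> \<open>The test function is the antiderivative of \<open>h\<close> from 0: it
      vanishes at b because \<open>h\<close> has mean 0, and it is C2 because \<open>h\<close> is a
      polynomial.\<close>
    proof (rule orth)
      show D: "((\<lambda>x. integral {0..x} h) has_real_derivative h t) (at t within {0..b})"
        if "t \<in> {0..b}" for t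
        using that by (intro integral_has_real_derivative h)
      have "(h has_real_derivative p' t) (at t within {0..b})" for t
        unfolding h_def
        by (auto intro!: derivative_eq_intros DERIV_subset[OF p'(2)])
      with D show "(\<lambda>x. integral {0..x} h) \<in> C2 b"
        unfolding C2_def using cont_p' by blast
    qed (use h h0 in auto)
    \<comment> \<open>\<open>R\<close> and \<open>Q\<close> differ by the constant \<open>c\<close>,
      which the mean-zero \<open>h\<close> does not see.\<close>
    with h0 have hR: "integral {0..b} (\<lambda>t. h t * R t) = 0"
      using integral_diff[of "\<lambda>t. h t * Q t" "{0..b}" "\<lambda>t. h t * c"]
        integrable_continuous_interval[OF continuous_on_mult[OF h Q]]
        integrable_on_cmult_right[OF integrable_continuous_interval[OF h], of c]
      by (simp add: R_def right_diff_distrib)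
    have "integral {0..b} (\<lambda>t. R t * R t) =
        integral {0..b} (\<lambda>t. R t * R t) - integral {0..b} (\<lambda>t. h t * R t)"
      by (simp add: hR)
    also have "\<dots> = integral {0..b} (\<lambda>t. R t * R t - h t * R t)"
      by (intro Henstock_Kurzweil_Integration.integral_diff[symmetric]
        integrable_continuous_interval continuous_intros h R)
    also have "\<dots> \<le> integral {0..b} (\<lambda>t. 2 * e * \<bar>R t\<bar>)"
    proof (rule integral_le)
      fix t assume t: "t \<in> {0..b}"
      have "R t * R t - h t * R t = (R t - h t) * R t" by (simp add: algebra_simps)
      also have "\<dots> \<le> \<bar>R t - h t\<bar> * \<bar>R t\<bar>" by (simp flip: abs_mult)
      also have "\<dots> \<le> 2 * e * \<bar>R t\<bar>"
        using p(2)[OF t] m by (intro mult_right_mono) (auto simp: h_def)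
      finally show "R t * R t - h t * R t \<le> 2 * e * \<bar>R t\<bar>" .
    qed (intro integrable_continuous_interval continuous_intros h R)+
    also have "\<dots> = 2 * e * N" by (simp add: N_def)
    finally show ?thesis .
  qed
  have "integral {0..b} (\<lambda>t. R t * R t) \<le> 0"
  proof (rule field_le_epsilon)
    fix d :: real assume "d > 0"
    \<comment> \<open>The denominator uses N + 1 because N may be 0.\<close>
    then have "integral {0..b} (\<lambda>t. R t * R t) \<le> 2 * (d / (2 * (N + 1))) * N"
      using N by (intro le) auto
    also have "\<dots> \<le> 0 + d" using N \<open>d > 0\<close> by (simp add: field_simps)
    finally show "integral {0..b} (\<lambda>t. R t * R t) \<le> 0 + d" .
  qed
  moreover have "0 \<le> integral {0..b} (\<lambda>t. R t * R t)"
    by (intro Henstock_Kurzweil_Integration.integral_nonneg integrable_continuous_interval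
        continuous_intros R) auto
  ultimately have "integral {0..b} (\<lambda>t. R t * R t) = 0" by simp
  then have "R t * R t = 0" if "t \<in> {0..b}" for t
    using integral_eq_0_iff[OF continuous_on_mult[OF R R] \<open>0 < b\<close>] that by auto
  then show ?thesis by (auto simp: R_def)
qed

section \<open>Vanishing of the first variation at an extremum\<close>

text \<open>Fermat's criterion in the real variable \<epsilon>: \<eta> vanishes at both ends, so
  every f + \<epsilon> \<eta> is admissible, and \<epsilon> = 0 is an extremum among small
  \<epsilon>.\<close>

lemma first_variation_eq_zero:
  assumes "local_extremum b (admissible b A C) J f"
    and \<eta>: "\<eta> \<in> C2 b" "\<eta> 0 = 0" "\<eta> b = 0" and "0 \<le> b"
    and D: "((\<lambda>\<epsilon>. J (\<lambda>t. f t + \<epsilon> * \<eta> t)) has_real_derivative l) (at 0)"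
  shows "l = 0"
proof -
  have f: "f \<in> admissible b A C"
    using assms(1) by (auto simp: local_extremum_def local_max_def local_min_def)
  then have adm: "(\<lambda>t. f t + \<epsilon> * \<eta> t) \<in> admissible b A C" for \<epsilon>
    using \<eta> by (auto simp: admissible_def intro: C2_add_scaled)
  have cont: "continuous_on {0..b} \<eta>"
    using C2_imp_C1[OF \<eta>(1)] by (metis DERIV_continuous_on)
  show ?thesis
    using assms(1) unfolding local_extremum_def
  proof
    assume "local_max b (admissible b A C) J f"
    then obtain \<delta> where \<delta>: "\<delta> > 0"
      "\<And>g. \<lbrakk>g \<in> admissible b A C; sup_norm b (\<lambda>t. g t - f t) < \<delta>\<rbrakk> \<Longrightarrow> J g \<le> J f"
      by (auto simp: local_max_def)
    obtain d where d: "d > 0" "\<And>\<epsilon>. \<bar>\<epsilon>\<bar> < d \<Longrightarrow> sup_norm b (\<lambda>t. \<epsilon> * \<eta> t) < \<delta>"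
      using sup_norm_scaled_less[OF cont \<open>0 \<le> b\<close> \<delta>(1)] by blast
    show ?thesis
      by (rule DERIV_local_max[OF D d(1)]) (use d(2) \<delta>(2)[OF adm] in auto)
  next
    assume "local_min b (admissible b A C) J f"
    then obtain \<delta> where \<delta>: "\<delta> > 0"
      "\<And>g. \<lbrakk>g \<in> admissible b A C; sup_norm b (\<lambda>t. g t - f t) < \<delta>\<rbrakk> \<Longrightarrow> J f \<le> J g"
      by (auto simp: local_min_def)
    obtain d where d: "d > 0" "\<And>\<epsilon>. \<bar>\<epsilon>\<bar> < d \<Longrightarrow> sup_norm b (\<lambda>t. \<epsilon> * \<eta> t) < \<delta>"
      using sup_norm_scaled_less[OF cont \<open>0 \<le> b\<close> \<delta>(1)] by blast
    show ?thesis
      by (rule DERIV_local_min[OF D d(1)]) (use d(2) \<delta>(2)[OF adm] in auto)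
  qed
qed

section \<open>The fractional Euler-Lagrange equation\<close>

theorem theorem3p1:
  fixes \<alpha> b A C :: real
    and B :: "real \<Rightarrow> real"
    and L :: "real \<Rightarrow> real \<Rightarrow> real \<Rightarrow> real"
    and f :: "real \<Rightarrow> real"
  assumes "0 < \<alpha>" and "\<alpha> < 1" and "0 < b" and "0 < B \<alpha>"
    and "continuous_partials b L"
    and "\<forall>y\<in>C2 b. lagrangian_along B \<alpha> b L y integrable_on {0..b}"
    and "local_extremum b (admissible b A C) (action B \<alpha> b L) f"
  defines "L\<^sub>1 \<equiv> \<lambda>s. partial2 L s (f s) (abc_left B \<alpha> b f s)"
    and "L\<^sub>2 \<equiv> \<lambda>s. partial3 L s (f s) (abc_left B \<alpha> b f s)"
  shows "\<forall>s\<in>{0..b}. abr_right_exists_at \<alpha> b L\<^sub>2 s \<and> L\<^sub>1 s + abr_right B \<alpha> b L\<^sub>2 s = 0"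
proof -
  define k where "k = B \<alpha> / (1 - \<alpha>)"
  have "k > 0" using assms(2,4) by (simp add: k_def)
  define G where "G = abr_right_integral \<alpha> b L\<^sub>2"
  have f: "f \<in> C2 b"
    using assms(7) by (auto simp: local_extremum_def local_max_def local_min_def admissible_def)
  have cont_f: "continuous_on {0..b} f"
    using C2_imp_C1[OF f] by (metis DERIV_continuous_on)
  note cont_Df = continuous_on_abc_left[OF \<open>0 < \<alpha>\<close> \<open>0 < b\<close> f, of B]
  note cont_K = continuous_on_ml_kernel[OF \<open>0 < \<alpha>\<close>]
  have cont_L: "continuous_on {0..b} L\<^sub>1" "continuous_on {0..b} L\<^sub>2"
    unfolding L\<^sub>1_def L\<^sub>2_def
    by (intro continuous_on_partials_along[OF assms(5)] cont_f cont_Df continuous_on_id; simp)+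
  have cont_G: "continuous_on {0..b} G"
    unfolding G_def abr_right_integral_def[abs_def]
    by (rule continuous_on_right_convolution[OF cont_K cont_L(2)])
  have cont_P: "continuous_on {0..b} (\<lambda>t. integral {0..t} L\<^sub>1)"
    by (intro indefinite_integral_continuous_1 integrable_continuous_interval cont_L)
  have orth: "integral {0..b} (\<lambda>t. \<eta>' t * (k * G t - integral {0..t} L\<^sub>1)) = 0"
    if \<eta>: "\<eta> \<in> C2 b" "\<eta> 0 = 0" "\<eta> b = 0" "continuous_on {0..b} \<eta>'"
      "\<And>t. t \<in> {0..b} \<Longrightarrow> (\<eta> has_real_derivative \<eta>' t) (at t within {0..b})" for \<eta> \<eta>'
  proof -
    have cont_\<eta>: "continuous_on {0..b} \<eta>" by (rule DERIV_continuous_on[OF \<eta>(5)])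
    note cont_D\<eta> = continuous_on_abc_left[OF \<open>0 < \<alpha>\<close> \<open>0 < b\<close> \<eta>(1), of B]
    have along: "lagrangian_along B \<alpha> b L (\<lambda>x. f x + \<epsilon> * \<eta> x) t =
        L t (f t + \<epsilon> * \<eta> t) (abc_left B \<alpha> b f t + \<epsilon> * abc_left B \<alpha> b \<eta> t)"
      if "t \<in> {0..b}" for \<epsilon> t
      using abc_left_add_scaled[OF \<open>0 < \<alpha>\<close> \<open>0 < b\<close> f \<eta>(1) that, of B \<epsilon>]
      by (simp add: lagrangian_along_def)
    \<comment> \<open>Every varied function is again C2, so the integrability hypothesis applies for
      all \<epsilon>.\<close>
    have "(\<lambda>t. L t (f t + \<epsilon> * \<eta> t) (abc_left B \<alpha> b f t + \<epsilon> * abc_left B \<alpha> b \<eta> t))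
        integrable_on {0..b}" for \<epsilon>
    proof (rule integrable_eq)
      show "lagrangian_along B \<alpha> b L (\<lambda>x. f x + \<epsilon> * \<eta> x) integrable_on {0..b}"
        using assms(6) C2_add_scaled[OF f \<eta>(1)] by blast
    qed (rule along)
    note variation = first_variation[OF assms(5) cont_f cont_Df cont_\<eta> cont_D\<eta> this]
    have "action B \<alpha> b L (\<lambda>t. f t + \<epsilon> * \<eta> t) =
        integral {0..b} (\<lambda>t. L t (f t + \<epsilon> * \<eta> t)
          (abc_left B \<alpha> b f t + \<epsilon> * abc_left B \<alpha> b \<eta> t))" for \<epsilon>
      unfolding action_def by (rule integral_cong) (rule along)
    with variation have "((\<lambda>\<epsilon>. action B \<alpha> b L (\<lambda>t. f t + \<epsilon> * \<eta> t)) has_real_derivative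
        integral {0..b} (\<lambda>t. L\<^sub>1 t * \<eta> t + L\<^sub>2 t * abc_left B \<alpha> b \<eta> t)) (at 0)"
      unfolding L\<^sub>1_def L\<^sub>2_def by simp
    from first_variation_eq_zero[OF assms(7) \<eta>(1-3) less_imp_le[OF \<open>0 < b\<close>] this]
    have "0 = integral {0..b} (\<lambda>t. L\<^sub>1 t * \<eta> t + L\<^sub>2 t * abc_left B \<alpha> b \<eta> t)" by simp
    also have "\<dots> = integral {0..b} (\<lambda>t. L\<^sub>1 t * \<eta> t) +
        integral {0..b} (\<lambda>t. L\<^sub>2 t * abc_left B \<alpha> b \<eta> t)"
      by (intro integral_add integrable_continuous_interval continuous_intros
          cont_L cont_\<eta> cont_D\<eta>)
    also have "integral {0..b} (\<lambda>t. L\<^sub>2 t * abc_left B \<alpha> b \<eta> t) =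
        integral {0..b} (\<lambda>t. k * (L\<^sub>2 t * integral {0..t} (\<lambda>x. \<eta>' x * ml_kernel \<alpha> (t - x))))"
      by (rule integral_cong, subst abc_left_eq[OF \<eta>(5) \<open>0 < b\<close>]) (auto simp: k_def)
    \<comment> \<open>After the exchange the inner integral runs over [x, b] and is exactly
      \<open>G x\<close>.\<close>
    also have "\<dots> = k * integral {0..b} (\<lambda>t. \<eta>' t * G t)"
      using integral_swap_convolution[OF less_imp_le[OF \<open>0 < b\<close>] cont_K cont_L(2) \<eta>(4)]
      by (simp add: G_def abr_right_integral_def)
    also have "integral {0..b} (\<lambda>t. L\<^sub>1 t * \<eta> t) =
        - integral {0..b} (\<lambda>t. \<eta>' t * integral {0..t} L\<^sub>1)"
    proof -
      have ftc: "integral {0..t} \<eta>' = \<eta> t" if "t \<in> {0..b}" for t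
      proof -
        have "(\<eta>' has_integral \<eta> t - \<eta> 0) {0..t}"
        proof (rule fundamental_theorem_of_calculus)
          fix x assume "x \<in> {0..t}"
          then show "(\<eta> has_vector_derivative \<eta>' x) (at x within {0..t})"
            using \<eta>(5)[of x] that
            by (auto simp flip: has_real_derivative_iff_has_vector_derivative
                intro: DERIV_subset)
        qed (use that in auto)
        then show ?thesis by (simp add: \<eta>(2) integral_unique)
      qed
      \<comment> \<open>Since \<eta> vanishes at b, the integral of \<open>\<eta>'\<close> over
        [t, b] is -\<eta>(t); this produces the minus sign.\<close>
      have "integral {0..b} (\<lambda>t. L\<^sub>1 t * (integral {0..b} \<eta>' - integral {0..t} \<eta>')) =
          integral {0..b} (\<lambda>t. L\<^sub>1 t * - \<eta> t)"
        using \<open>0 < b\<close> by (intro integral_cong) (simp add: ftc \<eta>(3))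
      then show ?thesis
        using integral_by_parts_indefinite[OF less_imp_le[OF \<open>0 < b\<close>] cont_L(1) \<eta>(4)] by simp
    qed
    also have "- integral {0..b} (\<lambda>t. \<eta>' t * integral {0..t} L\<^sub>1) +
        k * integral {0..b} (\<lambda>t. \<eta>' t * G t) =
        integral {0..b} (\<lambda>t. k * (\<eta>' t * G t)) - integral {0..b} (\<lambda>t. \<eta>' t * integral {0..t} L\<^sub>1)"
      by simp
    also have "\<dots> = integral {0..b} (\<lambda>t. k * (\<eta>' t * G t) - \<eta>' t * integral {0..t} L\<^sub>1)"
      by (intro Henstock_Kurzweil_Integration.integral_diff[symmetric]
          integrable_continuous_interval continuous_intros \<eta>(4) cont_G cont_P)
    finally show ?thesis by (simp add: algebra_simps)
  qed
  have cont_Q: "continuous_on {0..b} (\<lambda>t. k * G t - integral {0..t} L\<^sub>1)"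
    by (intro continuous_intros cont_G cont_P)
  have "\<exists>c. \<forall>t\<in>{0..b}. k * G t - integral {0..t} L\<^sub>1 = c"
    by (rule du_Bois_Reymond_C2[OF \<open>0 < b\<close> cont_Q]) (rule orth)
  then obtain c where c: "\<And>t. t \<in> {0..b} \<Longrightarrow> k * G t - integral {0..t} L\<^sub>1 = c"
    by blast
  show ?thesis
  proof
    fix s assume s: "s \<in> {0..b}"
    \<comment> \<open>Solving the constancy relation for \<open>G\<close> exhibits it as an
      indefinite integral of a continuous function, so its derivative exists at the endpoints
      too.\<close>
    have "((\<lambda>t. (c + integral {0..t} L\<^sub>1) / k) has_real_derivative L\<^sub>1 s / k) (at s within {0..b})"
      using \<open>k > 0\<close>
      by (auto intro!: derivative_eq_intros integral_has_real_derivative cont_L s)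
    moreover have "(c + integral {0..t} L\<^sub>1) / k = G t" if "t \<in> {0..b}" for t
      using c[OF that] \<open>k > 0\<close> by (simp add: field_simps)
    ultimately have D: "(G has_real_derivative L\<^sub>1 s / k) (at s within {0..b})"
      by (rule has_field_derivative_transform_within[OF _ zero_less_one s])
    then have "vector_derivative G (at s within {0..b}) = L\<^sub>1 s / k"
      using \<open>0 < b\<close> s
      by (intro vector_derivative_within_closed_interval)
        (auto simp flip: has_real_derivative_iff_has_vector_derivative)
    moreover have "G differentiable (at s within {0..b})"
      using D by (auto simp: real_differentiable_def)
    \<comment> \<open>The factor -k in \<open>abr_right\<close> cancels the 1/k in the derivative of
      \<open>G\<close>.\<close>
    ultimately show "abr_right_exists_at \<alpha> b L\<^sub>2 s \<and> L\<^sub>1 s + abr_right B \<alpha> b L\<^sub>2 s = 0"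
      using \<open>k > 0\<close> unfolding abr_right_exists_at_def abr_right_def G_def[symmetric] k_def[symmetric]
      by simp
  qed
qed

end
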